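(* Let $p$ be an odd prime and let $f:\mathbb{F}_{p^{2k}}\to\mathbb{F}_p$ satisfy Condition A with sign $\epsilon$. Let $D'_{\mathcal S}=\{x\in\mathbb{F}_{p^{2k}}^*: f(x)\text{ is a square in }\mathbb{F}_p\text{ (including }0)\}$. Then $D'_{\mathcal S}$ is a $(v,d,\lambda_1,\lambda_2)$ partial difference set in the additive group of $\mathbb{F}_{p^{2k}}$, where $v=p^{2k}$, $d=\frac12(p^k+p^{k-1}+2\epsilon)(p^k-\epsilon)$, $\lambda_1=\frac14(p^k+p^{k-1}+2\epsilon)^2-\frac{3\epsilon}{2}(p^k+p^{k-1}+2\epsilon)+\epsilon p^k$, $\lambda_2=\frac14(p^k+p^{k-1})(p^k+p^{k-1}+2\epsilon)$.
   Context: Let $\zeta_p$ be a primitive complex $p$-th root of unity and $\mathrm{tr}$ the absolute trace from $\mathbb{F}_{p^{2k}}$ to $\mathbb{F}_p$. For $f:\mathbb{F}_{p^{2k}}\to\mathbb{F}_p$ the Walsh transform is $\mathcal{W}_f(b)=\sum_{x\in\mathbb{F}_{p^{2k}}}\zeta_p^{f(x)+\mathrm{tr}(bx)}$. Condition A: $p$ is an odd prime and $f:\mathbb{F}_{p^{2k}}\to\mathbb{F}_p$ satisfies $f(0)=0$, $f(-x)=f(x)$ for all $x$; there is an integer $l$ with $\gcd(l-1,p-1)=1$ such that $f(\alpha x)=\alpha^l f(x)$ for all $\alpha\in\mathbb{F}_p$, $x\in\mathbb{F}_{p^{2k}}$; and there exist a constant $\epsilon\in\{1,-1\}$ and a function $f^*:\mathbb{F}_{p^{2k}}\to\mathbb{F}_p$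 such that $\mathcal{W}_f(b)=\epsilon p^k\zeta_p^{f^*(b)}$ for all $b\in\mathbb{F}_{p^{2k}}$. A $d$-subset $D$ of a finite abelian group $G$ (written additively, of order $v$) with $0\notin D$ is a $(v,d,\lambda,\mu)$ partial difference set if every nonzero element of $D$ can be written as $g-h$ with $g,h\in D$ in exactly $\lambda$ ways, and every nonzero element of $G\setminus D$ can be written so in exactly $\mu$ ways. *)

theory Defs
  imports Complex_Main "HOL-Computational_Algebra.Primes"
begin

definition prime_subfield :: "'a::field set" where
  "prime_subfield = range of_nat"

text \<open>Absolute trace from F_(p^n) to F_p (values lie in the prime subfield).\<close>
definition abs_trace :: "nat \<Rightarrow> nat \<Rightarrow> 'a::field \<Rightarrow> 'a" where
  "abs_trace p n x = (\<Sum>i<n. x ^ (p ^ i))"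

text \<open>zeta to the power a, for a in the prime subfield, a = n mod p (well defined when zeta^p = 1).\<close>
definition zeta_pow :: "complex \<Rightarrow> 'a::field \<Rightarrow> complex" where
  "zeta_pow \<zeta> a = \<zeta> ^ (SOME n. of_nat n = a)"

definition walsh :: "nat \<Rightarrow> nat \<Rightarrow> complex \<Rightarrow> ('a::{field,finite} \<Rightarrow> 'a) \<Rightarrow> 'a \<Rightarrow> complex" where
  "walsh p k \<zeta> f b = (\<Sum>x\<in>UNIV. zeta_pow \<zeta> (f x + abs_trace p (2*k) (b * x)))"

definition is_pds :: "'a::{ab_group_add,finite} set \<Rightarrow> real \<Rightarrow> real \<Rightarrow> real \<Rightarrow> real \<Rightarrow> bool" where
  "is_pds D v d lam mu \<longleftrightarrow>
     real (card (UNIV :: 'a set)) = v \<and> real (card D) = d \<and> 0 \<notin> D \<and>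
     (\<forall>g. g \<noteq> 0 \<longrightarrow>
        real (card {(a, b). a \<in> D \<and> b \<in> D \<and> a - b = g}) = (if g \<in> D then lam else mu))"

end

theory Submission
  imports Defs "HOL-Computational_Algebra.Polynomial_Factorial" "HOL-Number_Theory.Cong"
begin

text \<open>
  By Fourier inversion on the additive group, a symmetric set \<open>D\<close> all of whose nontrivial character
  sums take one of two real values is a partial difference set, and the parameters can be read off.
  To evaluate the character sums of the preimage of the squares \<open>Q\<close>, expand the indicator function
  of \<open>Q\<close> in additive characters of \<open>F\<^sub>p\<close>. This reduces them to the sums of
  \<open>\<zeta>\<close> to the power \<open>\<alpha> f(x) + tr(b x)\<close> with \<open>\<alpha> \<noteq> 0\<close>. For \<open>\<alpha>\<close> of the form \<open>\<beta>\<close> to the power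
  \<open>l - 1\<close>, homogeneity and the Galois group of \<open>\<rat>(\<zeta>)\<close> identify this sum as \<open>\<epsilon> p\<^sup>k\<close> times
  \<open>\<zeta>\<close> to the power \<open>f\<^sup>*(b) / \<beta>\<close>. As \<open>l - 1\<close> is odd and prime to \<open>p - 1\<close>, the substitution
  \<open>\<alpha> \<mapsto> 1 / \<beta>\<close> permutes the nonzero residues and preserves their quadratic character. So
  resumming gives \<open>\<epsilon>\<close> times the indicator function of \<open>Q\<close> at \<open>f\<^sup>*(b)\<close>, up to scaling and
  a constant.
\<close>

section \<open>Cyclotomic polynomials of prime order\<close>

text \<open>As \<open>q\<close> has no root at \<open>a\<close>, the factor X - a must divide the
  cofactor \<open>s\<close> and can be cancelled, one power at a time.\<close>

lemma dvd_linear_power_imp_unit_or_root: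
  fixes q :: "'a::field poly"
  assumes "q dvd [:- a, 1:] ^ n" "poly q a \<noteq> 0"
  shows "q dvd 1"
  using assms
proof (induction n)
  case (Suc n)
  then obtain s where s: "[:- a, 1:] ^ Suc n = q * s"
    by (auto elim: dvdE)
  then have "poly (q * s) a = 0"
    by (metis poly_power poly_eq_0_iff_dvd dvd_power zero_less_Suc)
  then obtain t where "s = [:- a, 1:] * t"
    using Suc.prems(2) by (auto simp: poly_eq_0_iff_dvd elim: dvdE)
  with s have "[:- a, 1:] * [:- a, 1:] ^ n = [:- a, 1:] * (q * t)"
    by (metis power_Suc mult.left_commute)
  then have "[:- a, 1:] ^ n = q * t"
    by (simp only: mult_cancel_left) simp
  then show ?case
    using Suc by simp
qed simp

text \<open>For prime p this is the p-th cyclotomic polynomial. The coefficient ring is left open so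
  that it can be read over the integers, over the complex numbers and in characteristic p.\<close>

definition prime_cyclotomic :: "nat \<Rightarrow> 'a::comm_ring_1 poly" where
  "prime_cyclotomic p = (\<Sum>i<p. monom 1 i)"

lemma coeff_prime_cyclotomic: "coeff (prime_cyclotomic p) i = (if i < p then 1 else 0)"
  by (simp add: prime_cyclotomic_def coeff_sum)

lemma degree_prime_cyclotomic:
  assumes "p > 0"
  shows "degree (prime_cyclotomic p :: 'a::comm_ring_1 poly) = p - 1"
  by (rule antisym[OF degree_le le_degree]) (use assms in \<open>auto simp: coeff_prime_cyclotomic\<close>)

lemma poly_prime_cyclotomic: "poly (prime_cyclotomic p) x = (\<Sum>i<p. x ^ i)"
  by (simp add: prime_cyclotomic_def poly_sum poly_monom)

text \<open>Multiplied by X - 1, both sides become X^p - 1 = (X - 1)^p, by the Frobenius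
  identity.\<close>

lemma prime_cyclotomic_prime_char:
  assumes "CHAR('a::field) = p" "prime p"
  shows "(prime_cyclotomic p :: 'a poly) = [:- 1, 1:] ^ (p - 1)"
proof -
  let ?l = "[:- 1, 1:] :: 'a poly"
  have l: "?l = monom 1 1 - 1"
    by (simp add: monom_altdef one_pCons)
  have "?l * prime_cyclotomic p = monom 1 1 ^ p - 1"
    unfolding l prime_cyclotomic_def
    by (subst power_diff_1_eq) (auto simp: monom_power)
  also have "\<dots> = ?l ^ p"
  proof -
    have char: "CHAR('a poly) = p" using assms by simp
    have "(?l + 1) ^ p = ?l ^ p + 1"
      by (metis assms(2) char freshmans_dream power_one)
    moreover have "?l + 1 = monom 1 1"
      by (simp add: l)
    ultimately show ?thesis by simp
  qed
  also have "\<dots> = ?l * ?l ^ (p - 1)"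
    using power_minus_mult[OF prime_gt_0_nat[OF assms(2)], of ?l] by (simp only: mult.commute)
  finally show ?thesis
    by (simp only: mult_cancel_left) simp
qed

lemma poly_map_poly_of_int: "poly (map_poly of_int q) (of_int x :: 'a::comm_ring_1) = of_int (poly q x)"
  by (induction q) (simp_all add: map_poly_pCons)

lemma map_poly_of_int_mult:
  "(map_poly of_int (q * r) :: 'a::comm_ring_1 poly) = map_poly of_int q * map_poly of_int r"
  by (rule poly_eqI) (simp add: coeff_map_poly coeff_mult)

text \<open>
  Modulo \<open>p\<close> the polynomial is a power of \<open>X - 1\<close>, so both factors of a proper factorisation
  are divisible by \<open>p\<close> at 1, but their product is \<open>p\<close> there.
\<close>

lemma prime_cyclotomic_irreducible:
  assumes "CHAR('a::field) = p" "prime p"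
  shows "irreducible (prime_cyclotomic p :: int poly)"
proof (rule irreducibleI)
  have p2: "p \<ge> 2" using assms(2) by (rule prime_ge_2_nat)
  have deg: "degree (prime_cyclotomic p :: int poly) = p - 1"
    using p2 by (simp add: degree_prime_cyclotomic)
  have ne: "(prime_cyclotomic p :: int poly) \<noteq> 0"
    using p2 deg by auto
  show "(prime_cyclotomic p :: int poly) \<noteq> 0" by fact
  show "\<not> (prime_cyclotomic p :: int poly) dvd 1"
    using p2 deg by (auto simp: is_unit_poly_iff)
  fix q r :: "int poly"
  assume qr: "prime_cyclotomic p = q * r"
  have "lead_coeff q * lead_coeff r = lead_coeff (prime_cyclotomic p :: int poly)"
    by (simp add: qr lead_coeff_mult)
  also have "\<dots> = 1"
    using p2 by (simp add: deg coeff_prime_cyclotomic)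
  finally have lead: "lead_coeff q dvd 1" "lead_coeff r dvd 1"
    by (metis dvd_triv_left dvd_triv_right)+
  \<comment> \<open>If \<open>u\<close> does not vanish at 1 modulo p, its reduction divides a power
    of X - 1 without having the root 1, so it is a unit. The leading coefficient survives reduction,
    so \<open>u\<close> is itself constant, hence a unit.\<close>
  have dvd: "int p dvd poly u 1"
    if "u dvd prime_cyclotomic p" "lead_coeff u dvd 1" "\<not> u dvd 1" for u :: "int poly"
  proof (rule ccontr)
    let ?u = "map_poly of_int u :: 'a poly"
    assume "\<not> int p dvd poly u 1"
    then have "poly ?u (of_int 1) \<noteq> 0"
      unfolding poly_map_poly_of_int using assms of_int_eq_0_iff_char_dvd[where 'a='a] by auto
    moreover have "?u dvd prime_cyclotomic p"
    proof -
      from that(1) obtain w where "prime_cyclotomic p = u * w" by (auto elim: dvdE)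
      then have "map_poly of_int (prime_cyclotomic p :: int poly) = ?u * map_poly of_int w"
        by (simp add: map_poly_of_int_mult)
      moreover have "map_poly of_int (prime_cyclotomic p :: int poly) = (prime_cyclotomic p :: 'a poly)"
        by (rule poly_eqI) (simp add: coeff_map_poly coeff_prime_cyclotomic)
      ultimately show ?thesis by simp
    qed
    ultimately have "?u dvd 1"
      using dvd_linear_power_imp_unit_or_root[of ?u 1 "p - 1"] assms
      by (simp add: prime_cyclotomic_prime_char)
    then have "degree ?u = 0" by (auto simp: is_unit_poly_iff)
    moreover have "(of_int (lead_coeff u) :: 'a) \<noteq> 0"
      using that(2) by (auto simp: zdvd1_eq abs_if split: if_splits)
    then have "degree u \<le> degree ?u"
      by (intro le_degree) (simp add: coeff_map_poly)
    ultimately have "degree u = 0" by simp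
    then obtain c where "u = [:c:]" by (rule degree_eq_zeroE)
    with that(2,3) show False by (simp add: is_unit_const_poly_iff)
  qed
  show "q dvd 1 \<or> r dvd 1"
  proof (rule ccontr)
    assume "\<not> (q dvd 1 \<or> r dvd 1)"
    then have "int p * int p dvd poly q 1 * poly r 1"
      using lead qr by (intro mult_dvd_mono dvd) auto
    also have "poly q 1 * poly r 1 = int p"
      using arg_cong[OF qr, of "\<lambda>u. poly u 1"] by (simp add: poly_prime_cyclotomic)
    finally have "int (p * p) dvd int p" by simp
    then have "p * p dvd p" by (simp only: int_dvd_int_iff)
    then show False
      using p2 by (auto dest!: dvd_imp_le)
  qed
qed

text \<open>Let \<open>q\<close> have least degree among the nonzero integer polynomials vanishing
  at \<open>z\<close>. Pseudo-division makes every polynomial vanishing at \<open>z\<close> a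
  multiple of \<open>q\<close> after scaling by some nonzero \<open>c\<close>. Primality of the
  cyclotomic polynomial then disposes of \<open>c\<close>.\<close>

lemma prime_cyclotomic_dvd:
  fixes z :: complex and A :: "int poly"
  assumes "CHAR('a::field) = p" "prime p"
    and z: "z ^ p = 1" "z \<noteq> 1"
    and A: "poly (map_poly of_int A) z = 0"
  shows "prime_cyclotomic p dvd A"
proof -
  define ev where "ev q = poly (map_poly of_int q) z" for q :: "int poly"
  have ev_mult: "ev (q * r) = ev q * ev r" for q r
    by (simp add: ev_def map_poly_of_int_mult)
  have ev_add: "ev (q + r) = ev q + ev r" for q r
  proof -
    have "(map_poly of_int (q + r) :: complex poly) = map_poly of_int q + map_poly of_int r"
      by (rule poly_eqI) (simp add: coeff_map_poly)
    then show ?thesis by (simp add: ev_def)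
  qed
  have ev_const: "ev [:c:] = of_int c" for c
    by (simp add: ev_def map_poly_pCons)
  have ev_smult: "ev (smult c q) = of_int c * ev q" for c q
    using ev_mult[of "[:c:]" q] by (simp add: ev_const)
  have p2: "p \<ge> 2" using assms(2) by (rule prime_ge_2_nat)
  have deg: "degree (prime_cyclotomic p :: int poly) = p - 1"
    using p2 by (simp add: degree_prime_cyclotomic)
  then have ne: "(prime_cyclotomic p :: int poly) \<noteq> 0"
    using p2 by auto
  have prime_elem: "prime_elem (prime_cyclotomic p :: int poly)"
    using assms by (intro irreducible_imp_prime_poly prime_cyclotomic_irreducible)
  have phi: "ev (prime_cyclotomic p) = 0"
  proof -
    have "map_poly of_int (prime_cyclotomic p :: int poly) = (prime_cyclotomic p :: complex poly)"
      by (rule poly_eqI) (simp add: coeff_map_poly coeff_prime_cyclotomic)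
    then show ?thesis
      using z by (simp add: ev_def poly_prime_cyclotomic geometric_sum)
  qed
  let ?P = "\<lambda>q. q \<noteq> 0 \<and> ev q = 0"
  obtain q where q: "?P q" "\<And>r. ?P r \<Longrightarrow> degree q \<le> degree r"
    using ex_has_least_nat[of ?P "prime_cyclotomic p" degree] ne phi by blast
  have multiple: "\<exists>c t. c \<noteq> 0 \<and> smult c B = q * t" if "ev B = 0" for B
  proof -
    define r where "r = pseudo_mod B q"
    from pseudo_mod[of q B] q(1) obtain c t where c: "c \<noteq> 0" "smult c B = q * t + r"
      and r: "r = 0 \<or> degree r < degree q"
      by (auto simp: r_def)
    have "ev r = 0"
      using arg_cong[OF c(2), of ev] that q(1) by (simp add: ev_smult ev_add ev_mult)
    then have "r = 0"
      using r q(2)[of r] by (meson leD)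
    with c show ?thesis by auto
  qed
  have deg_q: "degree q > 0"
    using q(1) by (auto intro!: Nat.gr0I elim!: degree_eq_zeroE simp: ev_const)
  have phi_q: "prime_cyclotomic p dvd q"
  proof -
    obtain c t where ct: "c \<noteq> 0" "smult c (prime_cyclotomic p) = q * t"
      using multiple[OF phi] by blast
    then have "prime_cyclotomic p dvd q * t"
      by (metis dvd_refl dvd_smult)
    then have "prime_cyclotomic p dvd q \<or> prime_cyclotomic p dvd t"
      using prime_elem by (simp add: prime_elem_dvd_mult_iff)
    \<comment> \<open>Cancelling the cyclotomic polynomial would write the nonzero constant
      \<open>c\<close> as a multiple of the nonconstant \<open>q\<close>.\<close>
    moreover have False if "prime_cyclotomic p dvd t"
    proof -
      from that obtain u where "t = prime_cyclotomic p * u" by (auto elim: dvdE)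
      then have "prime_cyclotomic p * [:c:] = prime_cyclotomic p * (q * u)"
        using ct(2) by (simp add: mult_ac)
      then have qu: "[:c:] = q * u"
        using ne by (simp only: mult_cancel_left) simp
      with ct(1) have "q * u \<noteq> 0" by (metis pCons_eq_0_iff)
      then have "degree (q * u) = degree q + degree u"
        by (intro degree_mult_eq) auto
      with qu deg_q show False by (metis add_is_0 degree_pCons_0 less_numeral_extra(3))
    qed
    ultimately show ?thesis by blast
  qed
  obtain c t where ct: "c \<noteq> 0" "smult c A = q * t"
    using multiple[of A] A by (auto simp: ev_def)
  then have "prime_cyclotomic p dvd [:c:] * A"
    using phi_q by simp
  then have "prime_cyclotomic p dvd [:c:] \<or> prime_cyclotomic p dvd A"
    using prime_elem by (simp only: prime_elem_dvd_mult_iff)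
  moreover have "\<not> prime_cyclotomic p dvd [:c:]"
    using ct(1) deg p2 by (auto dest!: dvd_imp_degree_le)
  ultimately show ?thesis by blast
qed

section \<open>Additive characters of a finite field\<close>

text \<open>Multiplication by \<open>x\<close> permutes \<open>S\<close>, so the nonzero product
  over \<open>S\<close> does not change when every factor acquires \<open>x\<close>.\<close>

lemma power_card_closed_eq_1:
  fixes S :: "'a::field set"
  assumes "finite S" "0 \<notin> S" "x \<noteq> 0" "(*) x ` S = S"
  shows "x ^ card S = 1"
proof -
  have inj: "inj_on ((*) x) S"
    using \<open>x \<noteq> 0\<close> by (auto intro: inj_onI)
  have "\<Prod>S = (\<Prod>y\<in>S. x * y)"
    using assms(4) prod.reindex[OF inj, of "\<lambda>y. y"] by simp
  also have "\<dots> = x ^ card S * \<Prod>S"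
    by (simp add: prod.distrib)
  finally show ?thesis
    using assms(1,2) by (auto simp: prod_zero_iff)
qed

text \<open>As p is prime, the two conditions on \<open>\<zeta>\<close> make it a primitive p-th
  root of unity. The parameter \<open>ty\<close> carries the type of the field.\<close>

locale finite_field_root =
  fixes p n :: nat and \<zeta> :: complex and ty :: "'a::{field,finite} itself"
  assumes prime_p: "prime p"
    and card_field: "card (UNIV :: 'a set) = p ^ n"
    and zeta_power: "\<zeta> ^ p = 1"
    and zeta_neq_1: "\<zeta> \<noteq> 1"
begin

abbreviation F :: "'a set" where "F \<equiv> prime_subfield"
abbreviation \<chi> :: "'a \<Rightarrow> complex" where "\<chi> \<equiv> zeta_pow \<zeta>"
abbreviation tr :: "'a \<Rightarrow> 'a" where "tr \<equiv> abs_trace p n"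

section \<open>The prime subfield as the fixed field of Frobenius\<close>

lemma p_gt_0: "p > 0"
  using prime_p by (rule prime_gt_0_nat)

lemma n_gt_0: "n > 0"
proof (rule Nat.gr0I)
  assume "n = 0"
  then have "card (UNIV :: 'a set) = 1" using card_field by simp
  then obtain x where "(UNIV :: 'a set) = {x}" by (auto simp: card_1_singleton_iff)
  then show False by (metis UNIV_I singletonD zero_neq_one)
qed

text \<open>Translation by 1 permutes the field, so comparing the sums of all elements gives p^n = 0
  there. The characteristic is then a prime dividing p^n.\<close>

lemma CHAR_field: "CHAR('a) = p"
proof -
  have "(\<Sum>x\<in>UNIV. x + 1) = (\<Sum>x\<in>UNIV. x :: 'a)"
    by (rule sum.reindex_bij_witness[of _ "\<lambda>x. x - 1" "\<lambda>x. x + 1"]) auto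
  then have "of_nat (p ^ n) = (0 :: 'a)"
    by (simp add: sum.distrib card_field[symmetric])
  then have "CHAR('a) dvd p ^ n"
    by (simp only: of_nat_eq_0_iff_char_dvd)
  moreover have "prime CHAR('a)"
    by (intro prime_CHAR_semidom finite_imp_CHAR_pos) simp
  ultimately show ?thesis
    using prime_p by (metis prime_dvd_power primes_dvd_imp_eq)
qed

lemma of_nat_eq_iff: "of_nat i = (of_nat j :: 'a) \<longleftrightarrow> i mod p = j mod p"
  by (simp add: of_nat_eq_iff_cong_CHAR CHAR_field cong_def)

lemma inj_on_of_nat: "inj_on (of_nat :: nat \<Rightarrow> 'a) {..<p}"
  by (rule inj_onI) (simp add: of_nat_eq_iff)

lemma prime_subfield_eq: "F = of_nat ` {..<p}"
proof -
  have "of_nat i = (of_nat (i mod p) :: 'a)" for i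
    by (simp add: of_nat_eq_iff)
  then show ?thesis
    using p_gt_0 by (force simp: prime_subfield_def)
qed

lemma finite_F: "finite F"
  by simp

lemma card_F: "card F = p"
  by (simp add: prime_subfield_eq card_image inj_on_of_nat)

lemma add_power_p: "(x + y) ^ p = x ^ p + (y ^ p :: 'a)"
  by (rule freshmans_dream) (simp_all add: CHAR_field prime_p)

lemma of_nat_power_p: "(of_nat i :: 'a) ^ p = of_nat i"
  by (induction i) (use p_gt_0 in \<open>simp_all add: add_power_p\<close>)

text \<open>The p elements of \<open>F\<close> are roots of X^p - X, which has at most p roots.
  Closure of \<open>F\<close> under the field operations thus becomes a matter of p-th
  powers.\<close>

lemma F_iff: "x \<in> F \<longleftrightarrow> x ^ p = x"
proof -
  define q where "q = monom 1 p - (monom 1 1 :: 'a poly)"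
  have p2: "p \<ge> 2" using prime_p by (rule prime_ge_2_nat)
  have "coeff q p \<noteq> 0"
    using p2 by (simp add: q_def)
  then have ne: "q \<noteq> 0" by auto
  have "degree q \<le> p"
    unfolding q_def using p2 by (intro degree_diff_le) (auto simp: degree_monom_eq)
  then have le: "card {x. poly q x = 0} \<le> p"
    using card_poly_roots_bound[OF ne] by linarith
  have sub: "F \<subseteq> {x. poly q x = 0}"
    by (auto simp: prime_subfield_def q_def poly_monom of_nat_power_p)
  have "F = {x. poly q x = 0}"
    using sub le card_F by (intro card_seteq) auto
  then show ?thesis
    by (auto simp: q_def poly_monom)
qed

lemma F_0: "0 \<in> F" and F_1: "1 \<in> F"
  using p_gt_0 by (simp_all add: F_iff)

lemma F_add: "x \<in> F \<Longrightarrow> y \<in> F \<Longrightarrow> x + y \<in> F"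
  by (simp add: F_iff add_power_p)

lemma F_mult: "x \<in> F \<Longrightarrow> y \<in> F \<Longrightarrow> x * y \<in> F"
  by (simp add: F_iff power_mult_distrib)

lemma F_power: "x \<in> F \<Longrightarrow> x ^ m \<in> F"
  by (induction m) (simp_all add: F_1 F_mult)

lemma F_uminus: "x \<in> F \<Longrightarrow> - x \<in> F"
  using minus_power_prime_CHAR[OF CHAR_field[symmetric] prime_p, of x] by (simp add: F_iff)

lemma F_diff: "x \<in> F \<Longrightarrow> y \<in> F \<Longrightarrow> x - y \<in> F"
  using F_add[of x "- y"] by (simp add: F_uminus)

lemma F_divide: "x \<in> F \<Longrightarrow> y \<in> F \<Longrightarrow> x / y \<in> F"
  by (simp add: F_iff power_divide)

lemma F_inverse: "x \<in> F \<Longrightarrow> inverse x \<in> F"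
  using F_divide[OF F_1, of x] by (simp add: inverse_eq_divide)

lemma bij_betw_F_mult:
  assumes "t \<in> F" "t \<noteq> 0"
  shows "bij_betw ((*) t) F F"
  by (rule bij_betw_byWitness[where f' = "\<lambda>x. x / t"]) (use assms in \<open>auto intro: F_mult F_divide\<close>)

lemma F_fermat:
  assumes "t \<in> F" "t \<noteq> 0"
  shows "t ^ (p - 1) = 1"
proof -
  have "t ^ (p - 1) * t = 1 * t"
    using assms(1) power_minus_mult[OF p_gt_0, of t] by (simp only: F_iff mult_1)
  then show ?thesis
    using assms(2) by (metis mult_right_cancel)
qed

lemma power_card_field: "(x :: 'a) ^ (p ^ n) = x"
proof (cases "x = 0")
  case False
  have "x ^ card (UNIV - {0 :: 'a}) = 1"
  proof (rule power_card_closed_eq_1)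
    show "(*) x ` (UNIV - {0}) = UNIV - {0}"
    proof (intro equalityI subsetI)
      fix y assume "y \<in> UNIV - {0 :: 'a}"
      then show "y \<in> (*) x ` (UNIV - {0})"
        using False by (intro image_eqI[of _ _ "y / x"]) auto
    qed (use False in auto)
  qed (use False in auto)
  then have "x ^ (p ^ n - 1) = 1"
    by (simp add: card_Diff_singleton card_field)
  moreover have "x ^ (p ^ n - 1) * x = x ^ (p ^ n)"
    using p_gt_0 by (intro power_minus_mult) simp
  ultimately show ?thesis by simp
qed (use p_gt_0 in simp)

section \<open>The additive character of the prime subfield\<close>

text \<open>The exponent picked by \<open>SOME\<close> is determined only modulo p, which suffices
  because \<zeta>^p = 1.\<close>

lemma char_of_nat: "\<chi> (of_nat i) = \<zeta> ^ i"
proof -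
  have mod: "\<zeta> ^ (j mod p) = \<zeta> ^ j" for j
  proof -
    have "\<zeta> ^ j = \<zeta> ^ (p * (j div p) + j mod p)" by simp
    also have "\<dots> = \<zeta> ^ (j mod p)"
      unfolding power_add power_mult zeta_power by simp
    finally show ?thesis ..
  qed
  have "of_nat (SOME m. of_nat m = (of_nat i :: 'a)) = (of_nat i :: 'a)"
    by (rule someI) (rule refl)
  then show ?thesis
    unfolding zeta_pow_def of_nat_eq_iff by (metis mod)
qed

lemma char_0 [simp]: "\<chi> 0 = 1"
  using char_of_nat[of 0] by simp

lemma char_add: "x \<in> F \<Longrightarrow> y \<in> F \<Longrightarrow> \<chi> (x + y) = \<chi> x * \<chi> y"
  unfolding prime_subfield_def
  by clarify (simp add: char_of_nat power_add flip: of_nat_add)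

lemma char_eq_1_iff:
  assumes "t \<in> F"
  shows "\<chi> t = 1 \<longleftrightarrow> t = 0"
proof
  assume 1: "\<chi> t = 1"
  obtain i where i: "t = of_nat i"
    using assms by (auto simp: prime_subfield_def)
  show "t = 0"
  proof (rule ccontr)
    assume "t \<noteq> 0"
    then have "\<not> p dvd i"
      using i by (simp add: of_nat_eq_0_iff_char_dvd CHAR_field)
    then have "coprime i p"
      using prime_p by (metis prime_imp_coprime coprime_commute)
    moreover have "i \<noteq> 0" using \<open>t \<noteq> 0\<close> i by (metis of_nat_0)
    \<comment> \<open>By Bezout, \<zeta>^i = 1 with i prime to p would force \<zeta> = 1.\<close>
    ultimately obtain a b where "i * a = p * b + 1"
      using bezout_nat[of i p] by (auto simp: coprime_iff_gcd_eq_1)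
    then have "(\<zeta> ^ i) ^ a = (\<zeta> ^ p) ^ b * \<zeta>"
      by (simp add: power_add flip: power_mult)
    then show False
      using 1 zeta_neq_1 zeta_power by (simp add: i char_of_nat)
  qed
qed simp

text \<open>Orthogonality: for nonzero \<open>t\<close> a translation by \<open>t\<close> multiplies
  the sum by \<open>\<chi> t\<close>, which is not 1.\<close>

lemma sum_char_mult:
  assumes "t \<in> F"
  shows "(\<Sum>a\<in>F. \<chi> (t * a)) = (if t = 0 then of_nat p else 0)"
proof (cases "t = 0")
  case False
  have "(\<Sum>a\<in>F. \<chi> (t * a)) = (\<Sum>a\<in>F. \<chi> a)"
    using sum.reindex_bij_betw[OF bij_betw_F_mult[OF assms False], of \<chi>] .
  also have "\<dots> = (\<Sum>a\<in>F. \<chi> (t + a))"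
    by (rule sum.reindex_bij_witness[of _ "\<lambda>a. t + a" "\<lambda>a. a - t"])
       (use assms in \<open>auto intro: F_add F_diff\<close>)
  also have "\<dots> = \<chi> t * (\<Sum>a\<in>F. \<chi> a)"
    using assms by (simp add: char_add sum_distrib_left)
  finally have "(\<Sum>a\<in>F. \<chi> (t * a)) = \<chi> t * (\<Sum>a\<in>F. \<chi> a)" .
  moreover have "(\<Sum>a\<in>F. \<chi> (t * a)) = (\<Sum>a\<in>F. \<chi> a)" by fact
  ultimately show ?thesis
    using False char_eq_1_iff[OF assms] by auto
qed (simp add: card_F)

section \<open>Integer relations between p-th roots of unity\<close>

text \<open>The polynomial with coefficients \<open>c\<close> has degree below p and vanishes at
  \<zeta>, so it is a constant multiple of the cyclotomic polynomial.\<close>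

lemma char_int_relation:
  fixes c :: "'a \<Rightarrow> int"
  assumes "(\<Sum>a\<in>F. of_int (c a) * \<chi> a) = 0" "a \<in> F" "b \<in> F"
  shows "c a = c b"
proof -
  define A where "A = (\<Sum>i<p. monom (c (of_nat i)) i)"
  have coeff_A: "coeff A i = (if i < p then c (of_nat i) else 0)" for i
    by (simp add: A_def coeff_sum)
  have "poly (map_poly of_int A) \<zeta> = (\<Sum>i<p. of_int (c (of_nat i)) * \<zeta> ^ i)"
  proof -
    have "map_poly of_int A = (\<Sum>i<p. monom (of_int (c (of_nat i))) i :: complex poly)"
      by (rule poly_eqI) (simp add: coeff_map_poly coeff_A coeff_sum)
    then show ?thesis by (simp add: poly_sum poly_monom)
  qed
  also have "\<dots> = (\<Sum>a\<in>F. of_int (c a) * \<chi> a)"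
    by (simp add: prime_subfield_eq sum.reindex inj_on_of_nat char_of_nat)
  finally have "prime_cyclotomic p dvd A"
    using prime_cyclotomic_dvd[OF CHAR_field prime_p zeta_power zeta_neq_1] assms(1) by simp
  then obtain u where u: "A = prime_cyclotomic p * u" by (auto elim: dvdE)
  have "degree u = 0"
  proof (cases "u = 0")
    case False
    have deg: "degree (prime_cyclotomic p :: int poly) = p - 1"
      using p_gt_0 by (rule degree_prime_cyclotomic)
    moreover have "(prime_cyclotomic p :: int poly) \<noteq> 0"
      using coeff_prime_cyclotomic[of p 0, where 'a=int] p_gt_0 by auto
    ultimately have "degree A = (p - 1) + degree u"
      using False by (simp add: u degree_mult_eq)
    moreover have "degree A \<le> p - 1"
      by (rule degree_le) (auto simp: coeff_A)
    ultimately show ?thesis by simp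
  qed simp
  then obtain k where "u = [:k:]" by (rule degree_eq_zeroE)
  then have "coeff A i = (if i < p then k else 0)" for i
    by (simp add: u coeff_prime_cyclotomic)
  then have "c (of_nat i) = k" if "i < p" for i
    using coeff_A[of i] that by simp
  then show ?thesis
    using assms(2,3) by (auto simp: prime_subfield_eq)
qed

lemma sum_char_fibres:
  assumes "finite X" "g ` X \<subseteq> F"
  shows "(\<Sum>x\<in>X. h (g x)) = (\<Sum>a\<in>F. of_nat (card {x\<in>X. g x = a}) * (h a :: complex))"
proof -
  have "(\<Sum>x\<in>X. h (g x)) = (\<Sum>a\<in>F. \<Sum>x\<in>{x\<in>X. g x = a}. h (g x))"
    using assms by (intro sum.group[symmetric]) auto
  also have "\<dots> = (\<Sum>a\<in>F. of_nat (card {x\<in>X. g x = a}) * h a)"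
    by (intro sum.cong) auto
  finally show ?thesis .
qed

text \<open>Moving the right-hand side into the fibre counts gives an integer relation. So all
  fibres of \<open>g\<close> have the same size, apart from an excess of \<open>m\<close> over
  \<open>e\<close>.\<close>

lemma char_sum_fibres_const:
  assumes "finite X" "g ` X \<subseteq> F" "e \<in> F"
    and "(\<Sum>x\<in>X. \<chi> (g x)) = of_int m * \<chi> e"
    and "a \<in> F" "b \<in> F"
  shows "int (card {x\<in>X. g x = a}) - (if a = e then m else 0)
    = int (card {x\<in>X. g x = b}) - (if b = e then m else 0)"
proof (rule char_int_relation[of "\<lambda>a. int (card {x\<in>X. g x = a}) - (if a = e then m else 0)"])
  have "(\<Sum>a\<in>F. of_int (int (card {x\<in>X. g x = a}) - (if a = e then m else 0)) * \<chi> a)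
    = (\<Sum>a\<in>F. of_nat (card {x\<in>X. g x = a}) * \<chi> a - (if a = e then of_int m * \<chi> a else 0))"
    by (intro sum.cong) (auto simp: algebra_simps)
  also have "\<dots> = (\<Sum>a\<in>F. of_nat (card {x\<in>X. g x = a}) * \<chi> a) - (\<Sum>a\<in>F. if a = e then of_int m * \<chi> a else 0)"
    by (rule sum_subtractf)
  also have "\<dots> = 0"
    using assms(3,4) sum_char_fibres[OF assms(1,2), of \<chi>] by (simp add: sum.delta)
  finally show "(\<Sum>a\<in>F. of_int (int (card {x\<in>X. g x = a}) - (if a = e then m else 0)) * \<chi> a) = 0" .
qed (use assms in auto)

text \<open>The action of the Galois group of \<open>\<rat>(\<zeta>)\<close> on such an identity.\<close>

lemma char_sum_conjugate:
  assumes "finite X" "g ` X \<subseteq> F" "e \<in> F"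
    and "(\<Sum>x\<in>X. \<chi> (g x)) = of_int m * \<chi> e"
    and "t \<in> F" "t \<noteq> 0"
  shows "(\<Sum>x\<in>X. \<chi> (t * g x)) = of_int m * \<chi> (t * e)"
proof -
  define c where "c a = int (card {x\<in>X. g x = a}) - (if a = e then m else 0)" for a
  have c: "c a = c 0" if "a \<in> F" for a
    unfolding c_def using char_sum_fibres_const[OF assms(1-4) that F_0] .
  have "(\<Sum>x\<in>X. \<chi> (t * g x)) = (\<Sum>a\<in>F. of_nat (card {x\<in>X. g x = a}) * \<chi> (t * a))"
    using sum_char_fibres[OF assms(1,2), of "\<lambda>a. \<chi> (t * a)"] .
  also have "\<dots> = (\<Sum>a\<in>F. of_int (c a) * \<chi> (t * a) + (if a = e then of_int m * \<chi> (t * a) else 0))"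
    by (intro sum.cong) (auto simp: c_def algebra_simps)
  also have "\<dots> = (\<Sum>a\<in>F. of_int (c a) * \<chi> (t * a)) + of_int m * \<chi> (t * e)"
    using assms(3) by (simp add: sum.distrib sum.delta)
  \<comment> \<open>The corrected counts are constant, so orthogonality kills this sum and only the
    term at \<open>e\<close> survives.\<close>
  also have "(\<Sum>a\<in>F. of_int (c a) * \<chi> (t * a)) = (\<Sum>a\<in>F. of_int (c 0) * \<chi> (t * a))"
    by (intro sum.cong) (simp_all add: c)
  also have "\<dots> = 0"
    using sum_char_mult[OF assms(5)] assms(6) by (simp flip: sum_distrib_left)
  finally show ?thesis by simp
qed

section \<open>The absolute trace\<close>

lemma add_power_p_power: "(x + y) ^ (p ^ i) = x ^ (p ^ i) + (y ^ (p ^ i) :: 'a)"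
  by (rule freshmans_dream'[where n = i]) (simp_all add: CHAR_field prime_p)

lemma F_power_p_power: "t \<in> F \<Longrightarrow> t ^ (p ^ i) = t"
  by (induction i) (simp_all add: power_mult F_iff)

lemma trace_add: "tr (x + y) = tr x + tr y"
  by (simp add: abs_trace_def add_power_p_power sum.distrib)

lemma trace_mult: "t \<in> F \<Longrightarrow> tr (t * x) = t * tr x"
  by (simp add: abs_trace_def power_mult_distrib F_power_p_power sum_distrib_left)

lemma trace_0 [simp]: "tr 0 = 0"
  using trace_mult[OF F_0] by simp

text \<open>Frobenius permutes the summands of the trace cyclically; x^(p^n) = x closes the
  cycle.\<close>

lemma trace_in_F: "tr x \<in> F"
proof -
  have sum_power: "(\<Sum>i\<in>I. g i) ^ p = (\<Sum>i\<in>I. g i ^ p)" if "finite I" for I :: "nat set" and g :: "nat \<Rightarrow> 'a"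
    using that by induction (use p_gt_0 in \<open>simp_all add: add_power_p\<close>)
  have "tr x ^ p = (\<Sum>i<n. x ^ p ^ Suc i)"
    by (simp add: abs_trace_def sum_power power_Suc2 del: power_Suc flip: power_mult)
  also have "\<dots> = (\<Sum>i<n. x ^ p ^ i)"
    using sum.lessThan_Suc_shift[of "\<lambda>i. x ^ p ^ i" n] by (simp add: power_card_field)
  finally show ?thesis
    by (simp add: F_iff abs_trace_def)
qed

text \<open>The trace is a nonzero polynomial (its coefficient at X is 1) of degree less than p^n,
  so it cannot vanish on the whole field.\<close>

lemma trace_nonzero: "\<exists>x. tr x \<noteq> 0"
proof (rule ccontr)
  assume *: "\<nexists>x. tr x \<noteq> 0"
  define q where "q = (\<Sum>i<n. monom (1 :: 'a) (p ^ i))"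
  have p2: "p \<ge> 2" using prime_p by (rule prime_ge_2_nat)
  have "coeff q 1 = (\<Sum>i<n. if i = 0 then 1 else 0)"
    unfolding q_def coeff_sum using p2 by (intro sum.cong) auto
  then have ne: "q \<noteq> 0"
    using n_gt_0 by auto
  have "degree q \<le> p ^ (n - 1)"
    unfolding q_def
    using p2 by (intro degree_sum_le) (auto intro!: power_increasing simp: degree_monom_eq)
  also have "\<dots> < p ^ n"
    using p2 n_gt_0 by (intro power_strict_increasing) auto
  also have "\<dots> = card {x. poly q x = 0}"
    using * by (simp add: card_field q_def poly_sum poly_monom abs_trace_def)
  also have "\<dots> \<le> degree q"
    using ne by (rule card_poly_roots_bound)
  finally show False by simp
qed

section \<open>Orthogonality on the whole field and partial difference sets\<close>

lemma sum_char_trace: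
  "(\<Sum>b\<in>UNIV. \<chi> (tr (b * x))) = (if x = 0 then of_nat p ^ n else 0)"
proof (cases "x = 0")
  case False
  obtain y where y: "tr y \<noteq> 0" using trace_nonzero by blast
  let ?S = "\<Sum>b\<in>UNIV. \<chi> (tr (b * x))"
  have "?S = (\<Sum>b\<in>UNIV. \<chi> (tr ((y / x + b) * x)))"
    by (rule sum.reindex_bij_witness[of _ "\<lambda>b. y / x + b" "\<lambda>b. b - y / x"]) auto
  also have "\<dots> = \<chi> (tr y) * ?S"
    using False by (simp add: distrib_right trace_add char_add trace_in_F sum_distrib_left)
  finally show ?thesis
    using y False char_eq_1_iff[OF trace_in_F, of y] by auto
qed (simp add: card_field)

text \<open>
  Expand the number of representations of \<open>g\<close> by Fourier inversion; the two-valuedness turns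
  the square of the character sum into an affine function of it.
\<close>

lemma two_valued_char_sums_pds:
  fixes D :: "'a set" and \<theta>1 \<theta>2 :: real
  defines "\<mu> \<equiv> (real (card D) - \<theta>1) * (real (card D) - \<theta>2) / real p ^ n"
  assumes "0 \<notin> D" and sym: "\<And>x. x \<in> D \<Longrightarrow> - x \<in> D"
    and two: "\<And>b. b \<noteq> 0 \<Longrightarrow> (\<Sum>x\<in>D. \<chi> (tr (b * x))) \<in> {of_real \<theta>1, of_real \<theta>2}"
  shows "is_pds D (real p ^ n) (card D) (\<mu> + \<theta>1 + \<theta>2) \<mu>"
proof -
  define E where "E b = (\<Sum>x\<in>D. \<chi> (tr (b * x)))" for b
  define s t m :: complex where "s = of_real (\<theta>1 + \<theta>2)" and "t = of_real (\<theta>1 * \<theta>2)"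
    and "m = of_real ((real (card D) - \<theta>1) * (real (card D) - \<theta>2))"
  have E_0: "E 0 = of_nat (card D)"
    by (simp add: E_def)
  \<comment> \<open>Symmetry of \<open>D\<close> lets the square of \<open>E b\<close> play the role
    of its squared absolute value.\<close>
  have E_sym: "E b = (\<Sum>x\<in>D. \<chi> (tr (b * (- x))))" for b
    unfolding E_def
    by (rule sum.reindex_bij_witness[of _ uminus uminus]) (auto simp: sym)
  \<comment> \<open>\<theta>1 and \<theta>2 are the roots of X^2 - sX + t. At b = 0 the sum is
    \<open>card D\<close>, and \<open>m\<close> is the value of this quadratic there.\<close>
  have E_square: "E b * E b = s * E b - t + (if b = 0 then m else 0)" for b
  proof (cases "b = 0")
    case False
    then have "E b = of_real \<theta>1 \<or> E b = of_real \<theta>2"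
      using two[of b] by (simp add: E_def)
    then show ?thesis
      using False by (auto simp: s_def t_def algebra_simps)
  qed (simp add: E_0 s_def t_def m_def algebra_simps)
  have char_trace_add: "\<chi> (tr (b * x)) * \<chi> (tr (b * y)) = \<chi> (tr (b * (x + y)))" for b x y
    by (simp add: distrib_left trace_add char_add trace_in_F)
  have count: "real (card {(a, b). a \<in> D \<and> b \<in> D \<and> a - b = g}) = (if g \<in> D then \<mu> + \<theta>1 + \<theta>2 else \<mu>)"
    if "g \<noteq> 0" for g
  proof -
    let ?N = "card {(a, b). a \<in> D \<and> b \<in> D \<and> a - b = g}"
    have pn: "(of_nat p :: complex) ^ n \<noteq> 0" using p_gt_0 by simp
    have "(\<Sum>b\<in>UNIV. E b * E b * \<chi> (tr (b * (- g))))
      = (\<Sum>b\<in>UNIV. \<Sum>x\<in>D. \<Sum>y\<in>D. \<chi> (tr (b * (x - y - g))))"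
    proof (rule sum.cong)
      fix b
      have "E b * E b = (\<Sum>x\<in>D. \<chi> (tr (b * x))) * (\<Sum>y\<in>D. \<chi> (tr (b * (- y))))"
        using E_sym[of b] by (simp add: E_def)
      also have "\<dots> = (\<Sum>x\<in>D. \<Sum>y\<in>D. \<chi> (tr (b * (x + (- y)))))"
        by (simp only: sum_product char_trace_add)
      finally show "E b * E b * \<chi> (tr (b * (- g))) = (\<Sum>x\<in>D. \<Sum>y\<in>D. \<chi> (tr (b * (x - y - g))))"
        by (simp only: sum_distrib_right char_trace_add) simp
    qed simp
    also have "\<dots> = (\<Sum>x\<in>D. \<Sum>b\<in>UNIV. \<Sum>y\<in>D. \<chi> (tr (b * (x - y - g))))"
      by (rule sum.swap)
    also have "\<dots> = (\<Sum>x\<in>D. \<Sum>y\<in>D. \<Sum>b\<in>UNIV. \<chi> (tr (b * (x - y - g))))"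
      by (intro sum.cong sum.swap refl)
    also have "\<dots> = (\<Sum>x\<in>D. \<Sum>y\<in>D. if x - y = g then of_nat p ^ n else 0)"
      by (simp add: sum_char_trace)
    also have "\<dots> = (\<Sum>z\<in>D \<times> D. if fst z - snd z = g then of_nat p ^ n else 0)"
      by (simp add: sum.cartesian_product case_prod_unfold)
    also have "\<dots> = (\<Sum>z\<in>{(a, b). a \<in> D \<and> b \<in> D \<and> a - b = g}. of_nat p ^ n)"
      by (rule sum.mono_neutral_cong_right) auto
    also have "\<dots> = of_nat p ^ n * of_nat ?N"
      by simp
    finally have 1: "(\<Sum>b\<in>UNIV. E b * E b * \<chi> (tr (b * (- g)))) = of_nat p ^ n * of_nat ?N" .
    have "(\<Sum>b\<in>UNIV. E b * \<chi> (tr (b * (- g)))) = (\<Sum>b\<in>UNIV. \<Sum>x\<in>D. \<chi> (tr (b * (x - g))))"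
      unfolding E_def sum_distrib_right char_trace_add by simp
    also have "\<dots> = (\<Sum>x\<in>D. \<Sum>b\<in>UNIV. \<chi> (tr (b * (x - g))))"
      by (rule sum.swap)
    also have "\<dots> = (if g \<in> D then of_nat p ^ n else 0)"
      by (simp add: sum_char_trace sum.delta)
    finally have 2: "(\<Sum>b\<in>UNIV. E b * \<chi> (tr (b * (- g)))) = (if g \<in> D then of_nat p ^ n else 0)" .
    have "(\<Sum>b\<in>UNIV. E b * E b * \<chi> (tr (b * (- g))))
      = (\<Sum>b\<in>UNIV. s * (E b * \<chi> (tr (b * (- g)))) - t * \<chi> (tr (b * (- g))) + (if b = 0 then m else 0))"
      unfolding E_square by (intro sum.cong) (auto simp: algebra_simps)
    also have "\<dots> = s * (\<Sum>b\<in>UNIV. E b * \<chi> (tr (b * (- g)))) - t * (\<Sum>b\<in>UNIV. \<chi> (tr (b * (- g)))) + m"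
      by (simp add: sum.distrib sum_subtractf sum.delta flip: sum_distrib_left)
    \<comment> \<open>The term with \<open>t\<close> vanishes because \<open>g\<close> is
      nonzero.\<close>
    also have "\<dots> = s * (if g \<in> D then of_nat p ^ n else 0) + m"
      unfolding 2 sum_char_trace using that by simp
    finally have "of_nat p ^ n * of_nat ?N = s * (if g \<in> D then of_nat p ^ n else 0) + m"
      using 1 by simp
    then have "(of_real (real p ^ n * real ?N) :: complex) =
        of_real ((\<theta>1 + \<theta>2) * (if g \<in> D then real p ^ n else 0) + (real (card D) - \<theta>1) * (real (card D) - \<theta>2))"
      by (simp add: s_def m_def split: if_splits)
    then have "real p ^ n * real ?N =
        (\<theta>1 + \<theta>2) * (if g \<in> D then real p ^ n else 0) + (real (card D) - \<theta>1) * (real (card D) - \<theta>2)"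
      by (simp only: of_real_eq_iff)
    then show ?thesis
      using p_gt_0 by (auto simp: \<mu>_def field_simps)
  qed
  then show ?thesis
    using assms(2) by (simp add: is_pds_def card_field)
qed

end

section \<open>Homogeneous bent functions\<close>

text \<open>The elements pair off as x and -x; the induction removes one pair.\<close>

lemma even_card_fixpoint_free_uminus:
  fixes S :: "'a::ab_group_add set"
  assumes "finite S" "\<And>x. x \<in> S \<Longrightarrow> - x \<in> S \<and> - x \<noteq> x"
  shows "even (card S)"
  using assms
proof (induction "card S" arbitrary: S rule: less_induct)
  case less
  show ?case
  proof (cases "S = {}")
    case False
    then obtain x where x: "x \<in> S" by blast
    with less.prems have x': "- x \<in> S" "- x \<noteq> x" by auto
    have *: "card S = Suc (Suc (card (S - {x} - {- x})))"
      using x x' less.prems(1) by (metis Diff_iff card_Suc_Diff1 finite_Diff singletonD)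
    have "even (card (S - {x} - {- x}))"
    proof (rule less.hyps)
      show "- y \<in> S - {x} - {- x} \<and> - y \<noteq> y" if "y \<in> S - {x} - {- x}" for y
        using that less.prems(2)[of y] by (metis Diff_iff add.inverse_inverse singleton_iff)
    qed (use * less.prems(1) in auto)
    with * show ?thesis by simp
  qed simp
qed

text \<open>Condition A. Coprimality is stated over the integers, where l - 1 may be -1.\<close>

locale homogeneous_bent = finite_field_root p "2 * k" \<zeta> ty
  for p k :: nat and \<zeta> :: complex and ty :: "'a::{field,finite} itself" +
  fixes f fstar :: "'a \<Rightarrow> 'a" and l :: nat and \<epsilon> :: int
  assumes odd_p: "odd p"
    and f_in_F: "f x \<in> F"
    and fstar_in_F: "fstar x \<in> F"
    and f_0: "f 0 = 0"
    and f_uminus: "f (- x) = f x"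
    and coprime_l: "coprime (int l - 1) (int p - 1)"
    and f_hom: "\<alpha> \<in> F \<Longrightarrow> f (\<alpha> * x) = \<alpha> ^ l * f x"
    and eps: "\<epsilon> \<in> {1, - 1}"
    and walsh_f: "walsh p k \<zeta> f b = of_int \<epsilon> * of_nat p ^ k * \<chi> (fstar b)"
begin

lemma k_gt_0: "k > 0"
  using n_gt_0 by simp

text \<open>As p - 1 is even, l - 1 has to be odd. This makes \<beta>^l a square, so that \<beta>^l
  / \<beta> and 1 / \<beta> have the same quadratic character.\<close>

lemma even_l: "even l"
proof (rule ccontr)
  assume "odd l"
  then have "2 dvd int l - 1" "2 dvd int p - 1"
    using odd_p by auto
  then have "is_unit (2 :: int)"
    using coprime_l by (rule coprime_common_divisor[rotated 1])
  then show False by simp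
qed

lemma uminus_neq_self: "x \<noteq> 0 \<Longrightarrow> - x \<noteq> (x :: 'a)"
proof
  assume "x \<noteq> 0" "- x = x"
  then have "of_nat 2 * x = 0"
    by (metis add.right_inverse mult_2 of_nat_numeral)
  then have "of_nat 2 = (0 :: 'a)"
    using \<open>x \<noteq> 0\<close> by simp
  then have "p dvd 2"
    by (simp only: of_nat_eq_0_iff_char_dvd CHAR_field)
  then have "p = 2"
    using prime_p two_is_prime_nat primes_dvd_imp_eq by blast
  with odd_p show False by simp
qed

section \<open>Squares of the prime subfield and their Fourier coefficients\<close>

text \<open>The roots range over \<open>F\<close> only: in the whole field, which contains the
  quadratic extension of \<open>F\<close>, every element of \<open>F\<close> is a square.\<close>

definition Q :: "'a set" where "Q = (\<lambda>y. y ^ 2) ` F"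

lemma Q_subset: "Q \<subseteq> F"
  by (auto simp: Q_def F_power)

lemma zero_in_Q: "0 \<in> Q"
  using F_0 by (force simp: Q_def)

lemma bij_betw_Q_mult:
  assumes "s \<in> F" "s \<noteq> 0"
  shows "bij_betw (\<lambda>i. s ^ 2 * i) Q Q"
proof (rule bij_betw_byWitness[where f' = "\<lambda>i. i / s ^ 2"])
  show "(\<lambda>i. s\<^sup>2 * i) ` Q \<subseteq> Q"
    using assms by (auto simp: Q_def F_mult simp flip: power_mult_distrib)
  show "(\<lambda>i. i / s\<^sup>2) ` Q \<subseteq> Q"
    using assms by (auto simp: Q_def F_divide simp flip: power_divide)
qed (use assms in auto)

text \<open>Squaring on \<open>F\<close> has one preimage over 0 and two over every other
  square.\<close>

lemma card_Q: "2 * card Q = p + 1"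
proof -
  have "p = card F"
    by (simp add: card_F)
  also have "\<dots> = (\<Sum>i\<in>Q. card {y\<in>F. y ^ 2 = i})"
    using sum.image_gen[OF finite_F, of "\<lambda>_. 1 :: nat" "\<lambda>y. y ^ 2"] by (simp add: Q_def)
  also have "\<dots> = (\<Sum>i\<in>Q. if i = 0 then 1 else 2)"
  proof (rule sum.cong)
    fix i assume "i \<in> Q"
    then obtain z where z: "z \<in> F" "i = z ^ 2" by (auto simp: Q_def)
    then have "{y\<in>F. y ^ 2 = i} = {z, - z}"
      by (auto simp: power2_eq_iff F_uminus)
    then show "card {y\<in>F. y ^ 2 = i} = (if i = 0 then 1 else 2)"
      using z uminus_neq_self[of z] by auto
  qed simp
  also have "\<dots> = 1 + (\<Sum>i\<in>Q - {0}. 2)"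
    by (subst sum.remove[OF _ zero_in_Q]) auto
  finally have "p = 1 + card (Q - {0}) * 2"
    by (simp only: sum_constant) simp
  moreover have "card Q = Suc (card (Q - {0}))"
    by (metis card_Suc_Diff1 finite zero_in_Q)
  ultimately show ?thesis by linarith
qed

text \<open>The Fourier coefficient of the indicator function of \<open>Q\<close>, up to the factor
  p. It equals (1 + G) / 2, where G is the quadratic Gauss sum of \<chi>(-\<alpha> y^2) over y in
  \<open>F\<close>.\<close>

definition gauss :: "'a \<Rightarrow> complex" where
  "gauss \<alpha> = (\<Sum>i\<in>Q. \<chi> (- (\<alpha> * i)))"

lemma gauss_0: "gauss 0 = of_nat (card Q)"
  by (simp add: gauss_def)

text \<open>Multiplication by s^2 permutes \<open>Q\<close>, so \<open>gauss\<close> sees only the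
  square class of its argument.\<close>

lemma gauss_square_mult:
  assumes "s \<in> F" "s \<noteq> 0"
  shows "gauss (s ^ 2 * \<alpha>) = gauss \<alpha>"
proof -
  have "gauss (s ^ 2 * \<alpha>) = (\<Sum>i\<in>Q. \<chi> (- (\<alpha> * (s ^ 2 * i))))"
    by (simp add: gauss_def mult_ac)
  also have "\<dots> = gauss \<alpha>"
    unfolding gauss_def
    using sum.reindex_bij_betw[OF bij_betw_Q_mult[OF assms], of "\<lambda>i. \<chi> (- (\<alpha> * i))"] .
  finally show ?thesis .
qed

text \<open>Fourier inversion on \<open>F\<close>, by exchanging the sums and applying
  orthogonality.\<close>

lemma sum_gauss:
  assumes "c \<in> F"
  shows "(\<Sum>\<alpha>\<in>F. gauss \<alpha> * \<chi> (\<alpha> * c)) = (if c \<in> Q then of_nat p else 0)"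
proof -
  have "(\<Sum>\<alpha>\<in>F. gauss \<alpha> * \<chi> (\<alpha> * c)) = (\<Sum>\<alpha>\<in>F. \<Sum>i\<in>Q. \<chi> ((c - i) * \<alpha>))"
  proof (rule sum.cong)
    fix \<alpha> assume "\<alpha> \<in> F"
    have "\<chi> (- (\<alpha> * i)) * \<chi> (\<alpha> * c) = \<chi> ((c - i) * \<alpha>)" if "i \<in> Q" for i
    proof -
      have "i \<in> F" using that Q_subset by blast
      then show ?thesis
        using \<open>\<alpha> \<in> F\<close> assms
        by (simp add: F_mult F_uminus algebra_simps flip: char_add)
    qed
    then show "gauss \<alpha> * \<chi> (\<alpha> * c) = (\<Sum>i\<in>Q. \<chi> ((c - i) * \<alpha>))"
      by (simp add: gauss_def sum_distrib_right)
  qed simp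
  also have "\<dots> = (\<Sum>i\<in>Q. \<Sum>\<alpha>\<in>F. \<chi> ((c - i) * \<alpha>))"
    by (rule sum.swap)
  also have "\<dots> = (\<Sum>i\<in>Q. if c = i then of_nat p else 0)"
    using assms Q_subset by (intro sum.cong) (auto simp: sum_char_mult F_diff subset_iff)
  finally show ?thesis by (simp add: sum.delta)
qed

text \<open>
  Writing \<open>\<beta>\<^sup>l / \<beta>\<close> for \<open>\<beta>\<close> to the power \<open>l - 1\<close> avoids truncated subtraction at \<open>l = 0\<close>.
\<close>

lemma bij_betw_power_l_div:
  "bij_betw (\<lambda>\<beta>. \<beta> ^ l / \<beta>) (F - {0}) (F - {0})"
proof -
  have "inj_on (\<lambda>\<beta>. \<beta> ^ l / \<beta>) (F - {0})"
  proof (rule inj_onI)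
    fix x y assume xy: "x \<in> F - {0}" "y \<in> F - {0}" and eq: "x ^ l / x = y ^ l / y"
    define u where "u = x / y"
    have u: "u \<in> F" "u \<noteq> 0"
      using xy by (auto simp: u_def F_divide)
    have "u ^ l = u"
      using eq xy by (simp add: u_def field_simps)
    then have 1: "u powi (int l - 1) = 1"
      using u by (simp add: power_int_diff)
    have "u powi (int p - 1) = u ^ (p - 1)"
      using p_gt_0 by (simp add: power_int_def nat_diff_distrib')
    then have 2: "u powi (int p - 1) = 1"
      using F_fermat[OF u] by simp
    \<comment> \<open>The quotient \<open>u\<close> has both its (l-1)-st and its (p-1)-st power
      equal to 1, so by Bezout over the integers it is 1.\<close>
    obtain a b where ab: "(int l - 1) * a + (int p - 1) * b = 1"
      using bezout_int[of "int l - 1" "int p - 1"] coprime_l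
      by (metis coprime_iff_gcd_eq_1 mult.commute)
    have "u = u powi ((int l - 1) * a + (int p - 1) * b)"
      by (simp add: ab)
    also have "\<dots> = (u powi (int l - 1)) powi a * (u powi (int p - 1)) powi b"
      using u by (simp add: power_int_add power_int_mult)
    finally show "x = y"
      using 1 2 xy by (simp add: u_def)
  qed
  moreover have "(\<lambda>\<beta>. \<beta> ^ l / \<beta>) ` (F - {0}) \<subseteq> F - {0}"
    by (auto intro: F_divide F_power)
  ultimately show ?thesis
    by (simp add: bij_betw_def endo_inj_surj)
qed

section \<open>Character sums of the preimage of the squares\<close>

lemma walsh_f_sum:
  "(\<Sum>x\<in>UNIV. \<chi> (f x + tr (b * x))) = of_int (\<epsilon> * int p ^ k) * \<chi> (fstar b)"
  using walsh_f[of b] by (simp add: walsh_def)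

text \<open>
  Substitute \<open>x \<mapsto> \<beta> x\<close> in the Walsh transform and raise \<open>\<zeta>\<close> to the power
  \<open>1 / \<beta>\<close>.
\<close>

lemma twisted_walsh:
  assumes "\<beta> \<in> F" "\<beta> \<noteq> 0"
  shows "(\<Sum>x\<in>UNIV. \<chi> (\<beta> ^ l / \<beta> * f x + tr (b * x))) = of_int (\<epsilon> * int p ^ k) * \<chi> (fstar b / \<beta>)"
proof -
  have "(\<Sum>x\<in>UNIV. \<chi> (\<beta> ^ l * f x + \<beta> * tr (b * x))) = (\<Sum>x\<in>UNIV. \<chi> (f (\<beta> * x) + tr (b * (\<beta> * x))))"
    using assms f_hom[OF assms(1)] trace_mult[OF assms(1)] by (simp add: mult.left_commute)
  also have "\<dots> = (\<Sum>x\<in>UNIV. \<chi> (f x + tr (b * x)))"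
    by (rule sum.reindex_bij_witness[of _ "\<lambda>x. x / \<beta>" "\<lambda>x. \<beta> * x"]) (use assms in auto)
  also have "\<dots> = of_int (\<epsilon> * int p ^ k) * \<chi> (fstar b)"
    by (rule walsh_f_sum)
  finally have "(\<Sum>x\<in>UNIV. \<chi> (inverse \<beta> * (\<beta> ^ l * f x + \<beta> * tr (b * x))))
      = of_int (\<epsilon> * int p ^ k) * \<chi> (inverse \<beta> * fstar b)"
    using assms
    by (intro char_sum_conjugate) (auto intro!: F_add F_mult F_power trace_in_F f_in_F fstar_in_F F_inverse)
  then show ?thesis
    using assms by (simp add: field_simps)
qed

text \<open>Since \<open>f\<close> is even, the fibre over 0 is the only one of odd size.\<close>

lemma fstar_0: "fstar 0 = 0"
proof (rule ccontr)
  assume ne: "fstar 0 \<noteq> 0"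
  let ?N = "\<lambda>a. card {x\<in>UNIV. f x = a}"
  have *: "even (card ({x. f x = a} - {0}))" for a
    by (rule even_card_fixpoint_free_uminus) (auto simp: f_uminus uminus_neq_self)
  have "(\<Sum>x\<in>UNIV. \<chi> (f x)) = of_int (\<epsilon> * int p ^ k) * \<chi> (fstar 0)"
    using walsh_f_sum[of 0] by simp
  \<comment> \<open>Both 0 and \<open>- fstar 0\<close> differ from \<open>fstar 0\<close>, so
    neither of these fibres carries the excess.\<close>
  then have "int (?N 0) - (if 0 = fstar 0 then \<epsilon> * int p ^ k else 0)
      = int (?N (- fstar 0)) - (if - fstar 0 = fstar 0 then \<epsilon> * int p ^ k else 0)"
    by (intro char_sum_fibres_const) (auto intro: f_in_F fstar_in_F F_0 F_uminus)
  then have "?N 0 = ?N (- fstar 0)"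
    using ne uminus_neq_self[OF ne] by auto
  moreover have "even (?N (- fstar 0))"
    using *[of "- fstar 0"] ne f_0 by (simp add: Diff_triv)
  moreover have "odd (?N 0)"
  proof -
    have "0 \<in> {x. f x = 0}" using f_0 by simp
    then have "card {x. f x = 0} = Suc (card ({x. f x = 0} - {0}))"
      by (metis card_Suc_Diff1 finite)
    with *[of 0] show ?thesis by simp
  qed
  ultimately show False by simp
qed

text \<open>For nonzero \<open>b\<close> the value depends only on whether \<open>fstar b\<close>
  lies in \<open>Q\<close>, which yields the two-valuedness.\<close>

lemma sum_preimage_Q:
  "of_nat p * (\<Sum>x | f x \<in> Q. \<chi> (tr (b * x)))
    = of_nat (card Q) * (if b = 0 then of_nat p ^ (2 * k) else 0)
      + of_int (\<epsilon> * int p ^ k) * ((if fstar b \<in> Q then of_nat p else 0) - of_nat (card Q))"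
proof -
  define T where "T \<alpha> = (\<Sum>x\<in>UNIV. \<chi> (\<alpha> * f x + tr (b * x)))" for \<alpha>
  let ?e = "of_int (\<epsilon> * int p ^ k) :: complex"
  have "of_nat p * (\<Sum>x | f x \<in> Q. \<chi> (tr (b * x)))
    = (\<Sum>x\<in>UNIV. (if f x \<in> Q then of_nat p else 0) * \<chi> (tr (b * x)))"
    by (simp add: sum_distrib_left if_distribR sum.If_cases if_distrib[of "\<lambda>z. z * _"] cong: if_cong)
  also have "\<dots> = (\<Sum>x\<in>UNIV. (\<Sum>\<alpha>\<in>F. gauss \<alpha> * \<chi> (\<alpha> * f x)) * \<chi> (tr (b * x)))"
    by (simp add: sum_gauss f_in_F)
  also have "\<dots> = (\<Sum>x\<in>UNIV. \<Sum>\<alpha>\<in>F. gauss \<alpha> * \<chi> (\<alpha> * f x + tr (b * x)))"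
    unfolding sum_distrib_right
    by (intro sum.cong) (simp_all add: char_add F_mult f_in_F trace_in_F)
  also have "\<dots> = (\<Sum>\<alpha>\<in>F. gauss \<alpha> * T \<alpha>)"
    unfolding T_def sum_distrib_left by (rule sum.swap)
  also have "\<dots> = gauss 0 * T 0 + (\<Sum>\<alpha>\<in>F - {0}. gauss \<alpha> * T \<alpha>)"
    by (rule sum.remove) (auto intro: F_0)
  also have "T 0 = (if b = 0 then of_nat p ^ (2 * k) else 0)"
    using sum_char_trace[of b] by (simp add: T_def mult.commute)
  \<comment> \<open>Every nonzero \<alpha> is \<beta>^l / \<beta> for a unique \<beta>, the form in
    which the twisted Walsh sum is known.\<close>
  also have "(\<Sum>\<alpha>\<in>F - {0}. gauss \<alpha> * T \<alpha>) = (\<Sum>\<beta>\<in>F - {0}. gauss (\<beta> ^ l / \<beta>) * T (\<beta> ^ l / \<beta>))"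
    using sum.reindex_bij_betw[OF bij_betw_power_l_div, of "\<lambda>\<alpha>. gauss \<alpha> * T \<alpha>"] by simp
  also have "\<dots> = (\<Sum>\<beta>\<in>F - {0}. gauss (inverse \<beta>) * (?e * \<chi> (inverse \<beta> * fstar b)))"
  proof (rule sum.cong)
    fix \<beta> assume \<beta>: "\<beta> \<in> F - {0}"
    have "\<beta> ^ l / \<beta> = (\<beta> ^ (l div 2)) ^ 2 * inverse \<beta>"
      using even_l by (simp add: field_simps flip: power_mult)
    then have "gauss (\<beta> ^ l / \<beta>) = gauss (inverse \<beta>)"
      using gauss_square_mult[of "\<beta> ^ (l div 2)"] \<beta> by (simp add: F_power)
    then show "gauss (\<beta> ^ l / \<beta>) * T (\<beta> ^ l / \<beta>) = gauss (inverse \<beta>) * (?e * \<chi> (inverse \<beta> * fstar b))"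
      using twisted_walsh[of \<beta> b] \<beta> by (simp add: T_def field_simps)
  qed simp
  also have "\<dots> = (\<Sum>\<beta>\<in>F - {0}. gauss \<beta> * (?e * \<chi> (\<beta> * fstar b)))"
    by (rule sum.reindex_bij_witness[of _ inverse inverse]) (auto intro: F_inverse)
  also have "\<dots> = ?e * (\<Sum>\<beta>\<in>F - {0}. gauss \<beta> * \<chi> (\<beta> * fstar b))"
    by (simp add: sum_distrib_left mult_ac)
  \<comment> \<open>Inversion on \<open>F\<close> needs the term at \<beta> = 0 as well, which is
    \<open>gauss 0\<close>, the size of \<open>Q\<close>.\<close>
  also have "(\<Sum>\<beta>\<in>F - {0}. gauss \<beta> * \<chi> (\<beta> * fstar b)) = (if fstar b \<in> Q then of_nat p else 0) - of_nat (card Q)"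
    using sum_gauss[OF fstar_in_F, of b] sum.remove[OF finite_F F_0, of "\<lambda>\<beta>. gauss \<beta> * \<chi> (\<beta> * fstar b)"]
    by (simp add: gauss_0 algebra_simps)
  finally show ?thesis
    by (simp add: gauss_0)
qed

section \<open>Parameters of the partial difference set\<close>

theorem preimage_Q_pds:
  "is_pds {x. x \<noteq> 0 \<and> f x \<in> Q}
     (real p ^ (2 * k))
     ((1/2) * (real p ^ k + real p ^ (k - 1) + 2 * of_int \<epsilon>) * (real p ^ k - of_int \<epsilon>))
     ((1/4) * (real p ^ k + real p ^ (k - 1) + 2 * of_int \<epsilon>) ^ 2
        - (3 * of_int \<epsilon> / 2) * (real p ^ k + real p ^ (k - 1) + 2 * of_int \<epsilon>)
        + of_int \<epsilon> * real p ^ k)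
     ((1/4) * (real p ^ k + real p ^ (k - 1)) * (real p ^ k + real p ^ (k - 1) + 2 * of_int \<epsilon>))"
proof -
  define D where "D = {x. x \<noteq> 0 \<and> f x \<in> Q}"
  define P where "P = real p ^ (k - 1)"
  define e where "e = real_of_int \<epsilon>"
  \<comment> \<open>These are the character sums for \<open>fstar b\<close> inside and outside
    \<open>Q\<close>. The -1 comes from removing x = 0 from the preimage.\<close>
  define \<theta>1 \<theta>2 where "\<theta>1 = e * P * (real p - 1) / 2 - 1" and "\<theta>2 = - (e * P * (real p + 1) / 2) - 1"
  have pk: "real p ^ k = real p * P"
    using k_gt_0 by (simp add: P_def power_eq_if)
  have p2k: "real p ^ (2 * k) = (real p * P) ^ 2"
    using pk by (metis power_mult mult.commute)
  have p_pos: "real p > 0" and P_pos: "P > 0"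
    using p_gt_0 by (simp_all add: P_def)
  have e: "e = 1 \<or> e = - 1"
    using eps by (auto simp: e_def)
  have Q: "real (card Q) = (real p + 1) / 2"
    using arg_cong[OF card_Q, of real] by simp
  define R where "R b = ((real p + 1) / 2 * (if b = 0 then (real p * P) ^ 2 else 0)
      + e * (real p * P) * ((if fstar b \<in> Q then real p else 0) - (real p + 1) / 2)) / real p - 1" for b
  have E: "(\<Sum>x\<in>D. \<chi> (tr (b * x))) = of_real (R b)" for b
  proof -
    let ?E = "\<Sum>x\<in>D. \<chi> (tr (b * x))"
    have "{x. f x \<in> Q} = insert 0 D"
      using f_0 zero_in_Q by (auto simp: D_def)
    then have "(\<Sum>x | f x \<in> Q. \<chi> (tr (b * x))) = 1 + ?E"
      by (simp add: D_def)
    then have "of_nat p * (1 + ?E) = of_nat (card Q) * (if b = 0 then of_nat p ^ (2 * k) else 0)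
      + of_int (\<epsilon> * int p ^ k) * ((if fstar b \<in> Q then of_nat p else 0) - of_nat (card Q))"
      using sum_preimage_Q[of b] by simp
    also have "\<dots> = of_real (real (card Q) * (if b = 0 then real p ^ (2 * k) else 0)
      + e * real p ^ k * ((if fstar b \<in> Q then real p else 0) - real (card Q)))"
      by (simp add: e_def)
    also have "\<dots> = of_real (real p * (R b + 1))"
      using p_pos by (simp add: R_def pk p2k Q)
    finally have "of_nat p * (1 + ?E) = of_nat p * (1 + of_real (R b))"
      by (simp add: add.commute)
    then show ?thesis
      using p_gt_0 by simp
  qed
  have "of_real (real (card D)) = (of_real (R 0) :: complex)"
    using E[of 0] by simp
  then have "real (card D) = R 0"
    by (simp only: of_real_eq_iff)
  \<comment> \<open>The trivial character counts \<open>D\<close>; \<open>fstar 0 = 0\<close> lies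
    in \<open>Q\<close> and so selects the branch.\<close>
  then have card_D: "real (card D) = ((real p + 1) * real p * P ^ 2 + e * P * (real p - 1)) / 2 - 1"
  proof -
    have "(real p + 1) / 2 * (real p * P) ^ 2 + e * (real p * P) * (real p - (real p + 1) / 2)
        = real p * (((real p + 1) * real p * P ^ 2 + e * P * (real p - 1)) / 2)"
      by (simp add: field_simps power2_eq_square)
    moreover have "R 0 = ((real p + 1) / 2 * (real p * P) ^ 2
        + e * (real p * P) * (real p - (real p + 1) / 2)) / real p - 1"
      using fstar_0 zero_in_Q by (simp add: R_def)
    ultimately show ?thesis
      using p_pos \<open>real (card D) = R 0\<close> by simp
  qed
  have "is_pds D (real p ^ (2 * k)) (card D)
      ((real (card D) - \<theta>1) * (real (card D) - \<theta>2) / real p ^ (2 * k) + \<theta>1 + \<theta>2)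
      ((real (card D) - \<theta>1) * (real (card D) - \<theta>2) / real p ^ (2 * k))"
  proof (rule two_valued_char_sums_pds)
    fix b :: 'a assume "b \<noteq> 0"
    then have "R b = \<theta>1 \<or> R b = \<theta>2"
      using p_pos by (simp add: R_def \<theta>1_def \<theta>2_def field_simps)
    then show "(\<Sum>x\<in>D. \<chi> (tr (b * x))) \<in> {of_real \<theta>1, of_real \<theta>2}"
      unfolding E by auto
  qed (auto simp: D_def f_uminus)
  moreover have "(real (card D) - \<theta>1) * (real (card D) - \<theta>2) / real p ^ (2 * k)
      = (1/4) * (real p * P + P) * (real p * P + P + 2 * e)"
  proof -
    \<comment> \<open>The factors are (p+1)pP^2/2 and pP((p+1)P + 2e)/2, so (pP)^2 splits
      off.\<close>
    have "(real (card D) - \<theta>1) * (real (card D) - \<theta>2)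
        = ((1/4) * (real p * P + P) * (real p * P + P + 2 * e)) * (real p * P) ^ 2"
      using e unfolding card_D \<theta>1_def \<theta>2_def power2_eq_square by (elim disjE) (simp_all add: field_simps)
    then show ?thesis
      using p_pos P_pos by (simp add: p2k)
  qed
  \<comment> \<open>Here \<theta>1 + \<theta>2 = -eP - 2; the case split on the sign supplies e^2 =
    1.\<close>
  moreover have "(1/4) * (real p * P + P) * (real p * P + P + 2 * e) + \<theta>1 + \<theta>2
      = (1/4) * (real p * P + P + 2 * e) ^ 2 - (3 * e / 2) * (real p * P + P + 2 * e) + e * (real p * P)"
    using e unfolding \<theta>1_def \<theta>2_def power2_eq_square by (elim disjE) (simp_all add: field_simps)
  moreover have "real (card D) = (1/2) * (real p * P + P + 2 * e) * (real p * P - e)"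
    using e unfolding card_D power2_eq_square by (elim disjE) (simp_all add: field_simps)
  ultimately show ?thesis
    unfolding D_def[symmetric] pk P_def[symmetric] e_def[symmetric] by (simp only:)
qed

end

theorem theorem3:
  fixes f fstar :: "'a::{field,finite} \<Rightarrow> 'a"
    and p k l :: nat and \<epsilon> :: int and \<zeta> :: complex
  assumes p: "prime p" "odd p"
    and card: "card (UNIV :: 'a set) = p ^ (2 * k)"
    and zeta: "\<zeta> ^ p = 1" "\<zeta> \<noteq> 1"
    and f_range: "\<forall>x. f x \<in> prime_subfield"
    and fstar_range: "\<forall>x. fstar x \<in> prime_subfield"
    and f0: "f 0 = 0"
    and f_even: "\<forall>x. f (- x) = f x"
    and l: "gcd (int l - 1) (int p - 1) = 1"
    and f_hom: "\<forall>\<alpha>\<in>prime_subfield. \<forall>x. f (\<alpha> * x) = \<alpha> ^ l * f x"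
    and eps: "\<epsilon> \<in> {1, -1}"
    and bent: "\<forall>b. walsh p k \<zeta> f b = of_int \<epsilon> * of_nat p ^ k * zeta_pow \<zeta> (fstar b)"
  shows "is_pds {x. x \<noteq> 0 \<and> (\<exists>y\<in>prime_subfield. f x = y ^ 2)}
           (real p ^ (2 * k))
           ((1/2) * (real p ^ k + real p ^ (k - 1) + 2 * of_int \<epsilon>) * (real p ^ k - of_int \<epsilon>))
           ((1/4) * (real p ^ k + real p ^ (k - 1) + 2 * of_int \<epsilon>) ^ 2
              - (3 * of_int \<epsilon> / 2) * (real p ^ k + real p ^ (k - 1) + 2 * of_int \<epsilon>)
              + of_int \<epsilon> * real p ^ k)
           ((1/4) * (real p ^ k + real p ^ (k - 1)) * (real p ^ k + real p ^ (k - 1) + 2 * of_int \<epsilon>))"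
proof -
  interpret homogeneous_bent p k \<zeta> "TYPE('a)" f fstar l \<epsilon>
    by unfold_locales (use assms in \<open>auto simp: coprime_iff_gcd_eq_1\<close>)
  have "{x. x \<noteq> 0 \<and> (\<exists>y\<in>prime_subfield. f x = y ^ 2)} = {x. x \<noteq> 0 \<and> f x \<in> Q}"
    by (auto simp: Q_def)
  then show ?thesis
    using preimage_Q_pds by (simp only:)
qed

end
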